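(* Let $q$ be a prime power and $m$ a positive integer. If there exists an $[\mathcal F,k,\delta]_{q^m}$ code, where $\mathcal F=[\gamma_0,\gamma_1,\ldots,\gamma_{n-1}]$ is a Ferrers diagram, then there exists an $[\mathcal F',mk,m\delta]_q$ code, where $$\mathcal F'=[\underbrace{m\gamma_0,\ldots,m\gamma_0}_{m},\underbrace{m\gamma_1,\ldots,m\gamma_1}_{m},\ldots,\underbrace{m\gamma_{n-1},\ldots,m\gamma_{n-1}}_{m}].$$
   Context: Ferrers diagrams. For positive integers $a,n$, an $a\times n$ Ferrers diagram is an $a\times n$ array of dots and empty cells such that all dots are shifted to the right, the number of dots in each row is at most the number of dots in the previous row, the first row has $n$ dots and the rightmost column has $a$ dots. It is identified with its column cardinalities: $\mathcal F=[\gamma_0,\gamma_1,\ldots,\gamma_{n-1}]$ with $1\leq\gamma_0\leq\gamma_1\leq\cdots\leq\gamma_{n-1}=a$, where the $(j+1)$-th column from the left has exactly $\gamma_j$ dots, located in its top $\gamma_j$ cells. Codes. For an $a\times n$ Ferrers diagram $\mathcal F$ and a prime power $Q$, an $[\mathcal F,k,\delta]_Q$ code (Ferrers diagram rank-metric code) is a $k$-dimensional $\mathbb F_Q$-linear subspace of $\mathbb F_Q^{a\times n}$ with minimum rank distance $\delta$ (the minimum of the ranks over $\mathbb F_Q$ of its nonzero matrices), such that in every matrix of the code all entries at positions not in $\mathcal F$ are zero. *)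

theory Defs
  imports
    "Jordan_Normal_Form.DL_Rank"
    "HOL-Number_Theory.Prime_Powers"
    "HOL-Library.Cardinality"
begin

text \<open>
  A Ferrers diagram is given by the list of its column cardinalities, from left to right.
\<close>

definition ferrers_diagram :: "nat \<Rightarrow> nat \<Rightarrow> nat list \<Rightarrow> bool" where
  "ferrers_diagram a n \<gamma> \<longleftrightarrow>
     a > 0 \<and> n > 0 \<and> length \<gamma> = n \<and> sorted \<gamma> \<and> (\<forall>j<n. 1 \<le> \<gamma> ! j) \<and> \<gamma> ! (n - 1) = a"

text \<open>
  Positions are (row, column), both counted from 0; column j is filled in its top cells.
\<close>

definition dots :: "nat list \<Rightarrow> (nat \<times> nat) set" where
  "dots \<gamma> = {(i, j). j < length \<gamma> \<and> i < \<gamma> ! j}"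

definition min_rank_distance :: "nat \<Rightarrow> nat \<Rightarrow> 'a::field mat set \<Rightarrow> nat \<Rightarrow> bool" where
  "min_rank_distance a n C \<delta> \<longleftrightarrow>
     (\<exists>M \<in> C - {0\<^sub>m a n}. vec_space.rank a M = \<delta>) \<and>
     (\<forall>M \<in> C - {0\<^sub>m a n}. \<delta> \<le> vec_space.rank a M)"

text \<open>
  The field is the element type \<open>'a\<close>; for an \<open>[F, k, d]\<close> code over the field with \<open>Q\<close> elements
  one takes \<open>CARD('a) = Q\<close>. The zero code has no nonzero matrix, hence no minimum rank
  distance, and is not a code for any \<open>\<delta>\<close>.
\<close>

definition ferrers_code ::
    "nat \<Rightarrow> nat \<Rightarrow> nat list \<Rightarrow> nat \<Rightarrow> nat \<Rightarrow> 'a::{field,finite} mat set \<Rightarrow> bool" where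
  "ferrers_code a n \<gamma> k \<delta> C \<longleftrightarrow>
     ferrers_diagram a n \<gamma> \<and>
     VectorSpace.subspace class_ring C (module_mat TYPE('a) a n) \<and>
     vectorspace.dim class_ring ((module_mat TYPE('a) a n)\<lparr>carrier := C\<rparr>) = k \<and>
     min_rank_distance a n C \<delta> \<and>
     (\<forall>M \<in> C. \<forall>i<a. \<forall>j<n. (i, j) \<notin> dots \<gamma> \<longrightarrow> M $$ (i, j) = 0)"

definition blow_up :: "nat \<Rightarrow> nat list \<Rightarrow> nat list" where
  "blow_up m \<gamma> = concat (map (\<lambda>g. replicate m (m * g)) \<gamma>)"

end

theory Submission
  imports Defs "HOL-Number_Theory.Residues" "Jordan_Normal_Form.Char_Poly"
begin

text \<open>
  Any field \<open>F\<close> with \<open>q\<close> elements embeds into any field \<open>K\<close> with \<open>q\<^sup>m\<close> elements, so \<open>K\<close> is a vector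
  space over \<open>F\<close> of dimension \<open>m\<close>. Replace every entry \<open>x\<close> of a matrix over \<open>K\<close> by the \<open>m \<times> m\<close>
  matrix over \<open>F\<close> of multiplication by \<open>x\<close>. As an \<open>F\<close>-linear map the new matrix is the old one,
  so the numbers of codewords and of vectors in its range do not change; counted as powers of \<open>q\<close>
  instead of \<open>q\<^sup>m\<close>, both the dimension of the code and all ranks are multiplied by \<open>m\<close>.
\<close>

section \<open>Embeddings of finite fields\<close>

lemma card_field_gt_1: "CARD('a::{field,finite}) > 1"
  using card_mono[of UNIV "{0, 1 :: 'a}"] by simp

lemma CHAR_eq_prime:
  assumes "prime p" and "CARD('a::{field,finite}) = p ^ e"
  shows "CHAR('a) = p"
proof -
  have "CHAR('a) dvd p ^ e" using CHAR_dvd_CARD[where 'a='a] assms(2) by simp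
  moreover have "prime CHAR('a)"
    by (intro prime_CHAR_semidom finite_imp_CHAR_pos) simp
  ultimately show ?thesis
    using assms(1) by (metis prime_dvd_power primes_dvd_imp_eq)
qed

text \<open>Multiplication by \<open>x\<close> permutes the nonzero elements, so their product picks
  up the factor \<open>x ^ (CARD('a) - 1)\<close> without changing; being nonzero, the product
  cancels.\<close>

lemma finite_field_power_card_minus_1:
  fixes x :: "'a::{field,finite}"
  assumes "x \<noteq> 0"
  shows "x ^ (CARD('a) - 1) = 1"
proof -
  let ?U = "UNIV - {0::'a}"
  have bij: "bij_betw ((*) x) ?U ?U"
    by (rule bij_betw_byWitness[where f' = "\<lambda>y. y / x"]) (use assms in auto)
  have "(\<Prod>y\<in>?U. y) = (\<Prod>y\<in>?U. x * y)"
    using prod.reindex_bij_betw[OF bij, of "\<lambda>y. y"] by simp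
  also have "\<dots> = x ^ (CARD('a) - 1) * (\<Prod>y\<in>?U. y)"
    by (simp add: prod.distrib)
  finally show ?thesis by simp
qed

lemma finite_field_power_card:
  fixes x :: "'a::{field,finite}"
  shows "x ^ CARD('a) = x"
proof (cases "x = 0")
  case False
  have "x ^ CARD('a) = x * x ^ (CARD('a) - 1)"
    by (metis finite_UNIV_card_ge_0 finite_class.finite_UNIV power_eq_if not_gr_zero)
  then show ?thesis using finite_field_power_card_minus_1[OF False] by simp
qed simp

lemma finite_field_generator:
  obtains g :: "'a::{field,finite}" where "\<And>x. x \<noteq> 0 \<Longrightarrow> \<exists>i. x = g ^ i"
proof -
  obtain g :: 'a where "carrier (mult_of (class_ring :: 'a ring)) = {g [^]\<^bsub>class_ring\<^esub> i | i::nat. i \<in> UNIV}"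
    using field.finite_field_mult_group_has_gen[OF class_field[where 'a='a]] by force
  then have "UNIV - {0} = {g ^ i | i. True}"
    by (simp add: class_ring_simps)
  then have "\<exists>i. x = g ^ i" if "x \<noteq> 0" for x using that by blast
  then show thesis by (rule that)
qed

text \<open>All nonzero elements of \<open>'K\<close> are roots of
  \<open>x ^ (q ^ m - 1) - 1\<close>, which is \<open>x ^ (q - 1) - 1\<close> times a cofactor
  \<open>S\<close>. The degree of \<open>S\<close> is at most \<open>q ^ m - q\<close>, so at least
  \<open>q\<close> elements, 0 included, are left as solutions of \<open>x ^ q = x\<close>.\<close>

lemma card_power_fixpoints:
  assumes card: "CARD('K::{field,finite}) = q ^ m" and q: "q > 1" and m: "m > 0"
  shows "q \<le> card {x :: 'K. x ^ q = x}"
proof -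
  define N where "N = (\<Sum>i<m. q ^ i)"
  have N: "q ^ m - 1 = (q - 1) * N"
  proof -
    have "int (q ^ m - 1) = int ((q - 1) * N)"
      using power_diff_1_eq[of "int q" m] q by (simp add: N_def of_nat_diff)
    then show ?thesis by (simp only: of_nat_eq_iff)
  qed
  have Npos: "N > 0" using m q by (auto simp: N_def intro!: sum_pos)
  \<comment> \<open>The geometric sum of \<open>N\<close> powers of \<open>x ^ (q - 1)\<close>,
    where \<open>N\<close> is the quotient of \<open>q ^ m - 1\<close> by
    \<open>q - 1\<close>.\<close>
  define S :: "'K poly" where "S = (\<Sum>i<N. Polynomial.monom 1 ((q - 1) * i))"
  have deg: "degree S \<le> (q - 1) * (N - 1)"
    unfolding S_def by (intro degree_sum_le) (auto intro!: order.trans[OF degree_monom_le])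
  \<comment> \<open>The root bound needs \<open>S\<close> nonzero, which its constant coefficient 1
    shows: as \<open>q > 1\<close>, only the term \<open>i = 0\<close> contributes to it.\<close>
  have "Polynomial.coeff S 0 = (\<Sum>i<N. if i = 0 then 1 else 0)"
    unfolding S_def coeff_sum using q by (intro sum.cong) auto
  then have "S \<noteq> 0" using Npos by (auto simp: S_def)
  have S: "(x ^ (q - 1) - 1) * poly S x = x ^ (q ^ m - 1) - 1" for x
    using power_diff_1_eq[of "x ^ (q - 1)" N]
    by (simp add: N[unfolded One_nat_def] S_def poly_sum poly_monom power_mult)
  have "UNIV \<subseteq> {x :: 'K. x ^ q = x} \<union> {x. poly S x = 0}"
  proof
    fix x :: 'K
    have "x ^ q = x * x ^ (q - 1)" using q by (simp add: power_eq_if)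
    then show "x \<in> {x. x ^ q = x} \<union> {x. poly S x = 0}"
      using S[of x] finite_field_power_card_minus_1[of x] card
      by (cases "x = 0") auto
  qed
  then have "q ^ m \<le> card ({x :: 'K. x ^ q = x} \<union> {x. poly S x = 0})"
    by (metis card card_mono finite)
  also have "\<dots> \<le> card {x :: 'K. x ^ q = x} + card {x. poly S x = 0}" by (rule card_Un_le)
  also have "card {x. poly S x = 0} \<le> (q - 1) * (N - 1)"
    using card_poly_roots_bound[OF \<open>S \<noteq> 0\<close>] deg by simp
  also have "(q - 1) * (N - 1) = q ^ m - q"
  proof -
    have "(q - 1) * (N - 1) = (q - 1) * N - (q - 1)" by (simp add: diff_mult_distrib2)
    then show ?thesis using N q by simp
  qed
  finally show ?thesis using q m self_le_power[of q m] by simp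
qed

text \<open>In either ring an integer coefficient becomes 0 exactly if the characteristic divides
  it. Integer polynomials thus serve as common representatives of polynomials over the prime fields
  of both.\<close>

lemma of_int_poly_eq_0_iff_CHAR:
  assumes "CHAR('a::comm_ring_1) = CHAR('b::comm_ring_1)"
  shows "of_int_poly P = (0 :: 'a poly) \<longleftrightarrow> of_int_poly P = (0 :: 'b poly)"
  using assms by (simp add: poly_eq_iff coeff_map_poly of_int_eq_0_iff_char_dvd)

text \<open>
  An integer polynomial \<open>P\<close> of least degree that vanishes at \<open>g\<close> without vanishing modulo the
  characteristic plays the role of the minimal polynomial of \<open>g\<close> over the prime field. It divides
  \<open>x\<^sup>q - x\<close> up to a unit, and the \<open>q\<close> zeros of the latter in \<open>K\<close> are too many for the cofactor alone.
\<close>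

lemma common_root_exists:
  fixes g :: "'F::{field,finite}"
  assumes char: "CHAR('K::{field,finite}) = CHAR('F)"
    and card: "CARD('K) = CARD('F) ^ m" and m: "m > 0"
  obtains r :: "'K::{field,finite}" where "\<And>A. poly (of_int_poly A) g = 0 \<Longrightarrow> poly (of_int_poly A) r = 0"
proof -
  let ?F = "of_int_poly :: int poly \<Rightarrow> 'F poly" and ?K = "of_int_poly :: int poly \<Rightarrow> 'K poly"
  define q where "q = CARD('F)"
  have q: "q > 1"
    unfolding q_def by (rule card_field_gt_1)
  have FK: "?F P = 0 \<longleftrightarrow> ?K P = 0" for P
    by (rule of_int_poly_eq_0_iff_CHAR[OF char[symmetric]])
  have int_FK: "(of_int c :: 'F) = 0 \<longleftrightarrow> (of_int c :: 'K) = 0" for c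
    using char by (simp add: of_int_eq_0_iff_char_dvd)
  define X :: "int poly" where "X = Polynomial.monom 1 q - Polynomial.monom 1 1"
  have XK: "?K X = Polynomial.monom 1 q - Polynomial.monom 1 1"
    by (simp add: X_def hom_distribs)
  have XF: "poly (?F X) g = 0"
    by (simp add: X_def hom_distribs poly_monom q_def finite_field_power_card)
  have degX: "degree (?K X) = q"
    unfolding XK diff_conv_add_uminus using q
    by (subst degree_add_eq_left) (auto simp: degree_monom_eq)
  then have X0: "?F X \<noteq> 0" using q FK by force
  define van where "van P \<longleftrightarrow> ?F P \<noteq> 0 \<and> poly (?F P) g = 0" for P
  obtain P where P: "van P" and minP: "\<And>R. degree R < degree P \<Longrightarrow> \<not> van R"
    using ex_has_least_nat[of van X degree] XF X0 unfolding van_def by (metis linorder_not_less)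
  define c where "c = lead_coeff P"
  \<comment> \<open>If the leading coefficient vanished in \<open>'F\<close>, dropping the leading
    term would lower the degree without changing the image over \<open>'F\<close>, against
    minimality; in degree 0 the image itself would be zero.\<close>
  have c: "(of_int c :: 'F) \<noteq> 0"
  proof
    assume c0: "(of_int c :: 'F) = 0"
    define R where "R = P - Polynomial.monom c (degree P)"
    have R: "?F R = ?F P" by (simp add: R_def hom_distribs c0)
    show False
    proof (cases "degree P = 0")
      case True
      then have "P = [:c:]" by (metis c_def degree_0_id)
      moreover have "?F [:c:] = 0" using c0 by (simp add: poly_eq_iff coeff_map_poly coeff_pCons split: nat.splits)
      ultimately show False using P by (simp add: van_def)
    next
      case False
      then have "degree R < degree P"
        by (intro degree_lessI) (auto simp: R_def c_def coeff_eq_0)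
      then show False using minP[of R] P R by (simp add: van_def)
    qed
  qed
  have cK: "(of_int c :: 'K) \<noteq> 0" using c int_FK by simp
  have degP: "degree (?K P) = degree P"
    using cK unfolding c_def by (intro antisym degree_map_poly_le le_degree) (simp add: coeff_map_poly)
  have P0: "P \<noteq> 0" using P by (auto simp: van_def)
  \<comment> \<open>Integer division by \<open>P\<close> is possible only after scaling by a power
    of \<open>c\<close>. The remainder vanishes at \<open>g\<close> and is too small in degree to
    satisfy \<open>van\<close>, so it is zero over \<open>'F\<close>, hence over
    \<open>'K\<close>.\<close>
  have div: "\<exists>e B. smult (of_int c ^ e) (?K A) = ?K P * ?K B" if A: "poly (?F A) g = 0" for A
  proof -
    obtain B R where BR: "pseudo_divmod A P = (B, R)" by fastforce
    define e where "e = Suc (degree A) - degree P"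
    have eq: "smult (c ^ e) A = P * B + R" and deg: "R = 0 \<or> degree R < degree P"
      using pseudo_divmod[OF P0 BR] by (simp_all add: e_def c_def)
    have "poly (?F (smult (c ^ e) A)) g = poly (?F (P * B + R)) g" using eq by simp
    then have "poly (?F R) g = 0" using A P by (simp add: hom_distribs van_def)
    then have "?F R = 0" using deg minP[of R] by (auto simp: van_def)
    then have "?K R = 0" using FK by simp
    moreover have "?K (smult (c ^ e) A) = ?K (P * B + R)" using eq by simp
    ultimately have "smult (of_int c ^ e) (?K A) = ?K P * ?K B" by (simp add: hom_distribs)
    then show ?thesis by blast
  qed
  \<comment> \<open>Without a zero of \<open>P\<close> in \<open>'K\<close>, all solutions of
    \<open>x ^ q = x\<close> would be zeros of the cofactor \<open>B\<close>. Then
    \<open>degree (?K B)\<close> is at least \<open>q\<close>, the sum of the degrees of both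
    factors, so \<open>P\<close> is constant; but its image over \<open>'F\<close> is then a nonzero
    constant, which cannot vanish at \<open>g\<close>.\<close>
  have "\<exists>r. poly (?K P) r = 0"
  proof (rule ccontr)
    assume no: "\<not> ?thesis"
    obtain e B where B: "smult (of_int c ^ e) (?K X) = ?K P * ?K B" using div[OF XF] by blast
    have KX0: "?K X \<noteq> 0" using X0 FK by simp
    then have KB: "?K B \<noteq> 0" using B cK by force
    have "{x :: 'K. x ^ q = x} \<subseteq> {x. poly (?K B) x = 0}"
    proof
      fix x :: 'K assume "x \<in> {x. x ^ q = x}"
      then have "poly (smult (of_int c ^ e) (?K X)) x = 0" by (simp add: XK poly_monom)
      then show "x \<in> {x. poly (?K B) x = 0}" using no unfolding B by simp
    qed
    then have "q \<le> card {x. poly (?K B) x = 0}"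
      using card_power_fixpoints[OF card[folded q_def] q m] card_mono[OF finite] le_trans by blast
    also have "\<dots> \<le> degree (?K B)" by (rule card_poly_roots_bound[OF KB])
    finally have 1: "q \<le> degree (?K B)" .
    have "q = degree (smult (of_int c ^ e) (?K X))" using cK degX by simp
    also have "\<dots> = degree (?K P) + degree (?K B)"
      unfolding B using P KB FK by (intro degree_mult_eq) (auto simp: van_def)
    finally have "degree P = 0" using 1 degP by simp
    then have "P = [:c:]" by (metis c_def degree_0_id)
    moreover have "?F [:c:] = [:of_int c:]"
      by (simp add: poly_eq_iff coeff_map_poly coeff_pCons split: nat.splits)
    ultimately show False using P c by (simp add: van_def)
  qed
  then obtain r where r: "poly (?K P) r = 0" by blast
  show thesis
  proof (rule that)
    fix A assume "poly (?F A) g = 0"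
    then obtain e B where "smult (of_int c ^ e) (?K A) = ?K P * ?K B" using div by blast
    from arg_cong[OF this, of "\<lambda>p. poly p r"] show "poly (?K A) r = 0" using r cK by simp
  qed
qed

text \<open>Every element of \<open>'F\<close> is the value at a generator \<open>g\<close> of an
  integer polynomial: 0 or a monomial. The embedding sends the value at \<open>g\<close> to the
  value at \<open>r\<close>; relations at \<open>g\<close> persist at \<open>r\<close>, so this is
  well defined and respects sums and products.\<close>

lemma finite_field_embedding:
  assumes char: "CHAR('K::{field,finite}) = CHAR('F::{field,finite})"
    and card: "CARD('K) = CARD('F) ^ m" and m: "m > 0"
  obtains \<phi> :: "'F::{field,finite} \<Rightarrow> 'K::{field,finite}" where "field_hom \<phi>"
proof -
  obtain g :: 'F where g: "\<And>x. x \<noteq> 0 \<Longrightarrow> \<exists>i. x = g ^ i" using finite_field_generator by blast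
  obtain r :: 'K where r: "\<And>A. poly (of_int_poly A) g = 0 \<Longrightarrow> poly (of_int_poly A) r = 0"
    using common_root_exists[OF char card m] by blast
  have "\<exists>A. poly (of_int_poly A) g = x" for x
  proof (cases "x = 0")
    case True
    then show ?thesis by (intro exI[of _ 0]) simp
  next
    case False
    then obtain i where "x = g ^ i" using g by blast
    then show ?thesis by (intro exI[of _ "Polynomial.monom 1 i"]) (simp add: poly_monom hom_distribs)
  qed
  then obtain A where A: "poly (of_int_poly (A x)) g = x" for x by metis
  define \<phi> where "\<phi> x = poly (of_int_poly (A x)) r" for x
  \<comment> \<open>Independence of the chosen representative: \<open>A x - B\<close> vanishes at
    \<open>g\<close>, hence at \<open>r\<close>.\<close>
  have \<phi>: "\<phi> x = poly (of_int_poly B) r" if "poly (of_int_poly B) g = x" for x B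
    using r[of "A x - B"] A that by (simp add: \<phi>_def hom_distribs)
  have "field_hom \<phi>"
  proof
    show "\<phi> 0 = 0" using \<phi>[of 0 0] by simp
    show "\<phi> 1 = 1" using \<phi>[of 1 1] by simp
    show "\<phi> (x + y) = \<phi> x + \<phi> y" for x y
      using \<phi>[of "A x + A y" "x + y"] A by (simp add: \<phi>_def hom_distribs)
    show "\<phi> (x * y) = \<phi> x * \<phi> y" for x y
      using \<phi>[of "A x * A y" "x * y"] A by (simp add: \<phi>_def hom_distribs)
  qed
  then show thesis by (rule that)
qed

section \<open>Dimension and rank by counting\<close>

text \<open>Vectors correspond to coordinate functions on a basis. Dimensions over different fields
  can thus be compared through cardinalities.\<close>

lemma (in vectorspace) card_carrier_eq_power_dim:
  assumes fin: "finite (carrier V)"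
  shows "card (carrier V) = card (carrier K) ^ dim"
proof -
  \<comment> \<open>The finite carrier is its own finite generating set, which makes a finite basis
    available.\<close>
  have "gen_set (carrier V)" by (meson in_own_span span_is_subset2 subset_antisym subset_refl)
  then have "fin_dim" unfolding fin_dim_def using fin by blast
  then obtain B where B: "finite B" "basis B" using finite_basis_exists by blast
  then have sub: "B \<subseteq> carrier V" by (simp add: basis_def)
  have ex1: "\<exists>!a. a \<in> B \<rightarrow>\<^sub>E carrier K \<and> lincomb a B = v" if "v \<in> carrier V" for v
    using basis_criterion[OF B(1) sub] B(2) that by blast
  have "bij_betw (\<lambda>a. lincomb a B) (B \<rightarrow>\<^sub>E carrier K) (carrier V)"
  proof (rule bij_betwI')
    fix a a' assume "a \<in> B \<rightarrow>\<^sub>E carrier K" "a' \<in> B \<rightarrow>\<^sub>E carrier K"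
    then show "(lincomb a B = lincomb a' B) = (a = a')"
      using ex1[of "lincomb a B"] sub lincomb_closed[of B a]
      by (metis PiE_iff Pi_I)
  next
    fix a assume "a \<in> B \<rightarrow>\<^sub>E carrier K"
    then show "lincomb a B \<in> carrier V" using sub by (intro lincomb_closed) (auto simp: PiE_iff)
  next
    fix v assume "v \<in> carrier V"
    then show "\<exists>a\<in>B \<rightarrow>\<^sub>E carrier K. v = lincomb a B" using ex1 by blast
  qed
  then have "card (carrier V) = card (B \<rightarrow>\<^sub>E carrier K)" by (simp add: bij_betw_same_card)
  also have "\<dots> = card (carrier K) ^ dim" using B by (simp add: card_PiE dim_basis)
  finally show ?thesis .
qed

lemma finite_carrier_mat: "finite (carrier_mat nr nc :: 'a::finite mat set)"
proof (rule finite_subset)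
  show "carrier_mat nr nc \<subseteq> mat nr nc ` (({..<nr} \<times> {..<nc}) \<rightarrow>\<^sub>E (UNIV :: 'a set))"
  proof
    fix A :: "'a mat" assume "A \<in> carrier_mat nr nc"
    then have "A = mat nr nc (restrict (($$) A) ({..<nr} \<times> {..<nc}))" by auto
    then show "A \<in> mat nr nc ` (({..<nr} \<times> {..<nc}) \<rightarrow>\<^sub>E (UNIV :: 'a set))"
      by (rule image_eqI[where f = "mat nr nc"]) simp
  qed
qed (intro finite_imageI finite_PiE; simp)

lemma finite_carrier_vec: "finite (carrier_vec n :: 'a::finite vec set)"
proof (rule finite_subset)
  show "carrier_vec n \<subseteq> (vec n ` ({..<n} \<rightarrow>\<^sub>E (UNIV :: 'a set)))"
  proof
    fix v :: "'a vec" assume "v \<in> carrier_vec n"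
    then have "v = vec n (restrict (($) v) {..<n})" by auto
    then show "v \<in> vec n ` ({..<n} \<rightarrow>\<^sub>E (UNIV :: 'a set))"
      by (rule image_eqI[where f = "vec n"]) simp
  qed
qed (intro finite_imageI finite_PiE; simp)

lemma card_subspace_mat:
  fixes C :: "'a::{field,finite} mat set"
  assumes "VectorSpace.subspace class_ring C (module_mat TYPE('a) nr nc)"
  shows "card C = CARD('a) ^ vectorspace.dim class_ring ((module_mat TYPE('a) nr nc)\<lparr>carrier := C\<rparr>)"
proof -
  interpret M: vectorspace class_ring "module_mat TYPE('a) nr nc" by (rule matrix_vs)
  have "finite C"
    using submodule.subset[OF M.is_module[OF assms]] finite_subset[OF _ finite_carrier_mat]
    by (simp add: module_mat_simps)
  then show ?thesis
    using vectorspace.card_carrier_eq_power_dim[OF M.subspace_is_vs[OF assms]] by simp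
qed

text \<open>The range of \<open>A\<close> is its column space, whose dimension is the rank.\<close>

lemma card_image_mult_mat_vec:
  fixes A :: "'a::{field,finite} mat"
  assumes "A \<in> carrier_mat nr nc"
  shows "card ((*\<^sub>v) A ` carrier_vec nc) = CARD('a) ^ vec_space.rank nr A"
proof -
  interpret vec_space "TYPE('a)" nr .
  have "col_space A = (*\<^sub>v) A ` carrier_vec nc"
    using col_space_eq[OF assms] assms by auto
  moreover have "VectorSpace.subspace class_ring (span (set (cols A))) V"
    using assms cols_dim span_is_subspace by (metis carrier_matD(1))
  then have "vectorspace class_ring (span_vs (set (cols A)))" by (rule subspace_is_vs)
  moreover have "finite ((*\<^sub>v) A ` carrier_vec nc)"
    by (intro finite_imageI finite_carrier_vec)
  ultimately show ?thesis
    using vectorspace.card_carrier_eq_power_dim[of class_ring "span_vs (set (cols A))"]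
    by (simp add: col_space_def rank_def)
qed

section \<open>Restriction of scalars for matrices\<close>

text \<open>Indices of expanded vectors and matrices run through \<open>n\<close> blocks of length
  \<open>m\<close>: \<open>J div m\<close> is the block and \<open>J mod m\<close> the place in
  it.\<close>

lemma sum_div_mod:
  fixes f :: "nat \<Rightarrow> nat \<Rightarrow> 'a::comm_monoid_add"
  assumes "m > 0"
  shows "(\<Sum>J<m * n. f (J div m) (J mod m)) = (\<Sum>j<n. \<Sum>t<m. f j t)"
proof -
  have "(\<Sum>J<m * n. f (J div m) (J mod m)) = (\<Sum>j<n. \<Sum>J = j * m..<j * m + m. f (J div m) (J mod m))"
    by (simp add: sum.nat_group mult.commute)
  also have "\<dots> = (\<Sum>j<n. \<Sum>t<m. f j t)"
  proof (rule sum.cong)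
    fix j
    have "(\<Sum>J = 0 + j * m..<m + j * m. f (J div m) (J mod m)) = (\<Sum>t = 0..<m. f j t)"
      unfolding sum.shift_bounds_nat_ivl using assms by (intro sum.cong) auto
    then show "(\<Sum>J = j * m..<j * m + m. f (J div m) (J mod m)) = (\<Sum>t<m. f j t)"
      by (simp add: add.commute atLeast0LessThan)
  qed simp
  finally show ?thesis .
qed

text \<open>\<open>'K\<close> as a vector space over \<open>'F\<close> through
  \<open>\<phi>\<close>, with basis \<open>b\<close> and coordinates \<open>c\<close>. The two
  equations state that \<open>b\<close> spans and that coordinates are unique; only indices below
  \<open>m\<close> matter.\<close>

locale field_coordinates = field_hom \<phi>
  for \<phi> :: "'F::{field,finite} \<Rightarrow> 'K::{field,finite}" +
  fixes m :: nat and b :: "nat \<Rightarrow> 'K" and c :: "'K \<Rightarrow> nat \<Rightarrow> 'F"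
  assumes m_pos: "m > 0"
    and expansion: "(\<Sum>i<m. \<phi> (c x i) * b i) = x"
    and coords_sum: "i < m \<Longrightarrow> c (\<Sum>j<m. \<phi> (f j) * b j) i = f i"
begin

lemma coords_add: "i < m \<Longrightarrow> c (x + y) i = c x i + c y i"
  using coords_sum[of i "\<lambda>i. c x i + c y i"] expansion[of x] expansion[of y]
  by (simp add: hom_add distrib_right sum.distrib)

lemma coords_scale: "i < m \<Longrightarrow> c (\<phi> a * x) i = a * c x i"
  using coords_sum[of i "\<lambda>i. a * c x i"] expansion[of x]
  by (simp add: hom_mult mult.assoc flip: sum_distrib_left)

lemma coords_0: "i < m \<Longrightarrow> c 0 i = 0"
  using coords_scale[of i 0 0] by simp

lemma coords_of_sum: "i < m \<Longrightarrow> c (\<Sum>x\<in>S. h x) i = (\<Sum>x\<in>S. c (h x) i)"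
  by (induction S rule: infinite_finite_induct) (auto simp: coords_0 coords_add)

lemma coords_eqI: "(\<And>i. i < m \<Longrightarrow> c x i = c y i) \<Longrightarrow> x = y"
  by (subst (1 2) expansion[symmetric]) simp

text \<open>The numbers \<open>c (x * b t) s\<close> form the matrix of multiplication by
  \<open>x\<close>; this is one entry of its product with the coordinate vector of
  \<open>y\<close>.\<close>

lemma coords_mult: "s < m \<Longrightarrow> (\<Sum>t<m. c (x * b t) s * c y t) = c (x * y) s"
proof -
  assume s: "s < m"
  have "c (x * y) s = c (x * (\<Sum>t<m. \<phi> (c y t) * b t)) s" by (simp only: expansion)
  also have "\<dots> = c (\<Sum>t<m. \<phi> (c y t) * (x * b t)) s"
    by (simp only: sum_distrib_left mult.left_commute)
  also have "\<dots> = (\<Sum>t<m. c y t * c (x * b t) s)"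
    by (simp only: coords_of_sum[OF s] coords_scale[OF s])
  finally show ?thesis by (simp add: mult.commute)
qed

text \<open>Restriction of scalars for vectors: each entry becomes the block of its \<open>m\<close>
  coordinates.\<close>

definition flat_vec :: "'K vec \<Rightarrow> 'F vec" where
  "flat_vec v = vec (m * dim_vec v) (\<lambda>J. c (v $ (J div m)) (J mod m))"

text \<open>Every entry is replaced by the matrix of multiplication by it in the basis \<open>b\<close>.\<close>

definition expand_mat :: "'K mat \<Rightarrow> 'F mat" where
  "expand_mat A = mat (m * dim_row A) (m * dim_col A)
     (\<lambda>(I, J). c (A $$ (I div m, J div m) * b (J mod m)) (I mod m))"

lemma flat_vec_carrier: "v \<in> carrier_vec n \<Longrightarrow> flat_vec v \<in> carrier_vec (m * n)"
  by (auto simp: flat_vec_def)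

lemma expand_mat_carrier: "A \<in> carrier_mat nr nc \<Longrightarrow> expand_mat A \<in> carrier_mat (m * nr) (m * nc)"
  by (auto simp: expand_mat_def)

lemma block_div_less: "I < m * n \<Longrightarrow> I div m < n"
  by (simp add: less_mult_imp_div_less mult.commute)

lemma block_index_less: "i < n \<Longrightarrow> s < m \<Longrightarrow> m * i + s < m * n"
proof -
  assume "i < n" "s < m"
  then have "m * i + s < m * Suc i" by simp
  also have "\<dots> \<le> m * n" using \<open>i < n\<close> by (intro mult_le_mono) auto
  finally show ?thesis .
qed

lemma bij_betw_flat_vec: "bij_betw flat_vec (carrier_vec n) (carrier_vec (m * n))"
proof (rule bij_betw_imageI)
  show "inj_on flat_vec (carrier_vec n)"
  proof (rule inj_onI)
    fix v w :: "'K vec"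
    assume v: "v \<in> carrier_vec n" and w: "w \<in> carrier_vec n" and eq: "flat_vec v = flat_vec w"
    have "c (v $ j) s = c (w $ j) s" if "j < n" "s < m" for j s
      using arg_cong[OF eq, of "\<lambda>u. u $ (m * j + s)"] v w that block_index_less[OF that]
      by (simp add: flat_vec_def)
    then show "v = w" using v w by (intro eq_vecI coords_eqI) auto
  qed
  show "flat_vec ` carrier_vec n = carrier_vec (m * n)"
  proof (intro equalityI subsetI)
    fix w :: "'F vec" assume w: "w \<in> carrier_vec (m * n)"
    \<comment> \<open>The preimage reassembles each entry from its block of coordinates.\<close>
    define v where "v = vec n (\<lambda>j. \<Sum>t<m. \<phi> (w $ (m * j + t)) * b t)"
    have "w = flat_vec v"
      using w m_pos by (intro eq_vecI) (auto simp: flat_vec_def v_def block_div_less coords_sum)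
    then show "w \<in> flat_vec ` carrier_vec n" by (auto simp: v_def)
  qed (auto simp: flat_vec_carrier)
qed

text \<open>The expanded matrix is the same linear map in \<open>'F\<close>-coordinates:
  \<open>coords_mult\<close> handles each block, and additivity of the coordinates handles the sum
  over blocks.\<close>

lemma expand_mat_mult_flat_vec:
  assumes A: "A \<in> carrier_mat nr nc" and v: "v \<in> carrier_vec nc"
  shows "expand_mat A *\<^sub>v flat_vec v = flat_vec (A *\<^sub>v v)"
proof (rule eq_vecI)
  fix I assume "I < dim_vec (flat_vec (A *\<^sub>v v))"
  then have I: "I < m * nr" using A by (simp add: flat_vec_def)
  have s: "I mod m < m" using m_pos by simp
  have "(expand_mat A *\<^sub>v flat_vec v) $ I =
      (\<Sum>J<m * nc. c (A $$ (I div m, J div m) * b (J mod m)) (I mod m) * c (v $ (J div m)) (J mod m))"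
    using A v I by (simp add: expand_mat_def flat_vec_def scalar_prod_def atLeast0LessThan)
  also have "\<dots> = (\<Sum>j<nc. \<Sum>t<m. c (A $$ (I div m, j) * b t) (I mod m) * c (v $ j) t)"
    using m_pos by (rule sum_div_mod)
  also have "\<dots> = c (\<Sum>j<nc. A $$ (I div m, j) * v $ j) (I mod m)"
    using s by (simp add: coords_mult coords_of_sum)
  also have "\<dots> = flat_vec (A *\<^sub>v v) $ I"
    using A v I by (simp add: flat_vec_def scalar_prod_def atLeast0LessThan block_div_less)
  finally show "(expand_mat A *\<^sub>v flat_vec v) $ I = flat_vec (A *\<^sub>v v) $ I" .
qed (use A in \<open>simp add: expand_mat_def flat_vec_def\<close>)

lemma expand_mat_add:
  assumes "A \<in> carrier_mat nr nc" "B \<in> carrier_mat nr nc"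
  shows "expand_mat (A + B) = expand_mat A + expand_mat B"
  using assms m_pos by (intro eq_matI) (auto simp: expand_mat_def block_div_less coords_add distrib_right)

lemma expand_mat_smult: "expand_mat (\<phi> a \<cdot>\<^sub>m A) = a \<cdot>\<^sub>m expand_mat A"
  using m_pos by (intro eq_matI) (auto simp: expand_mat_def block_div_less coords_scale mult.assoc)

lemma expand_mat_zero: "expand_mat (0\<^sub>m nr nc) = 0\<^sub>m (m * nr) (m * nc)"
  using m_pos by (intro eq_matI) (auto simp: expand_mat_def block_div_less coords_0)

lemma range_expand_mat:
  assumes A: "A \<in> carrier_mat nr nc"
  shows "(*\<^sub>v) (expand_mat A) ` carrier_vec (m * nc) = flat_vec ` (*\<^sub>v) A ` carrier_vec nc"
proof -
  have "(*\<^sub>v) (expand_mat A) ` carrier_vec (m * nc) = (*\<^sub>v) (expand_mat A) ` flat_vec ` carrier_vec nc"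
    using bij_betw_flat_vec by (simp add: bij_betw_def)
  then show ?thesis
    using expand_mat_mult_flat_vec[OF A] by (simp add: image_image)
qed

text \<open>Since \<open>flat_vec\<close> is injective, the expanded matrix determines the products
  of \<open>A\<close> with unit vectors, that is, the columns of \<open>A\<close>.\<close>

lemma inj_on_expand_mat: "inj_on expand_mat (carrier_mat nr nc)"
proof (rule inj_onI)
  fix A B :: "'K mat"
  assume A: "A \<in> carrier_mat nr nc" and B: "B \<in> carrier_mat nr nc" and eq: "expand_mat A = expand_mat B"
  have "A $$ (i, j) = B $$ (i, j)" if i: "i < nr" and j: "j < nc" for i j
  proof -
    let ?u = "unit_vec nc j :: 'K vec"
    have "flat_vec (A *\<^sub>v ?u) = flat_vec (B *\<^sub>v ?u)"
      using expand_mat_mult_flat_vec[OF A, of ?u] expand_mat_mult_flat_vec[OF B, of ?u] eq by simp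
    moreover have "A *\<^sub>v ?u \<in> carrier_vec nr" "B *\<^sub>v ?u \<in> carrier_vec nr" using A B by auto
    ultimately have "A *\<^sub>v ?u = B *\<^sub>v ?u"
      using bij_betw_imp_inj_on[OF bij_betw_flat_vec] by (metis inj_onD)
    then have "(A *\<^sub>v ?u) $ i = (B *\<^sub>v ?u) $ i" by simp
    then show ?thesis using A B i j by simp
  qed
  then show "A = B" using A B by (intro eq_matI) auto
qed

end

text \<open>Take any basis \<open>B\<close> of \<open>'K\<close> over \<open>'F\<close>. Counting
  coordinate functions gives \<open>CARD('F) ^ card B = CARD('F) ^ m\<close>, so \<open>B\<close>
  has \<open>m\<close> elements and can be enumerated.\<close>

lemma field_coordinates_exist:
  fixes \<phi> :: "'F::{field,finite} \<Rightarrow> 'K::{field,finite}"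
  assumes \<phi>: "field_hom \<phi>" and card: "CARD('K) = CARD('F) ^ m" and m: "m > 0"
  obtains b c where "field_coordinates \<phi> m b c"
proof -
  interpret field_hom \<phi> by (rule \<phi>)
  interpret V: Vector_Spaces.vector_space "\<lambda>a x. \<phi> a * x"
    by unfold_locales (auto simp: algebra_simps hom_add hom_mult)
  obtain B where B: "V.independent B" "V.span B = UNIV"
    using V.basis_exists[of UNIV] by (metis top.extremum_unique)
  have inv: "V.representation B (\<Sum>x\<in>B. \<phi> (f x) * x) y = f y" if "y \<in> B" for f y
    using B that
    by (simp add: V.representation_sum V.representation_scale V.representation_basis
        if_distrib[of "\<lambda>x. _ * x"] cong: if_cong)
  have exp: "(\<Sum>y\<in>B. \<phi> (V.representation B x y) * y) = x" for x
    using B by (intro V.sum_representation_eq) auto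
  have "bij_betw (\<lambda>x. restrict (V.representation B x) B) UNIV (B \<rightarrow>\<^sub>E (UNIV :: 'F set))"
    by (rule bij_betw_byWitness[where f' = "\<lambda>f. \<Sum>x\<in>B. \<phi> (f x) * x"])
      (auto simp: exp inv PiE_def extensional_def)
  then have "CARD('K) = card (B \<rightarrow>\<^sub>E (UNIV :: 'F set))" by (rule bij_betw_same_card)
  then have "CARD('F) ^ m = CARD('F) ^ card B" by (simp add: card card_PiE)
  then have "card B = m" using card_field_gt_1[where 'a='F] by simp
  then obtain h where h: "bij_betw h {..<m} B"
    using ex_bij_betw_nat_finite[of B] by (metis atLeast0LessThan finite)
  have "field_coordinates \<phi> m h (\<lambda>x i. V.representation B x (h i))"
  proof
    show "(\<Sum>i<m. \<phi> (V.representation B x (h i)) * h i) = x" for x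
      using sum.reindex_bij_betw[OF h, of "\<lambda>y. \<phi> (V.representation B x y) * y"] exp by simp
    show "V.representation B (\<Sum>j<m. \<phi> (f j) * h j) (h i) = f i" if i: "i < m" for f i
    proof -
      \<comment> \<open>The coefficients \<open>f\<close>, indexed by numbers, are moved along
        \<open>h\<close> to the elements of \<open>B\<close>, where \<open>inv\<close>
        applies.\<close>
      define f' where "f' y = f (the_inv_into {..<m} h y)" for y
      have f': "f' (h j) = f j" if "j < m" for j
        using that h by (simp add: f'_def bij_betw_def the_inv_into_f_f)
      have "(\<Sum>j<m. \<phi> (f j) * h j) = (\<Sum>y\<in>B. \<phi> (f' y) * y)"
        by (subst sum.reindex_bij_betw[OF h, symmetric]) (auto simp: f' intro: sum.cong)
      then show ?thesis using inv[of "h i" f'] i h f' by (auto simp: bij_betw_def)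
    qed
  qed (rule m)
  then show thesis by (rule that)
qed

text \<open>\<open>flat_vec\<close> maps the range of \<open>A\<close> bijectively onto that of the
  expanded matrix. The common size is a power of \<open>CARD('F)\<close> in two ways, and the
  exponents are compared.\<close>

lemma (in field_coordinates) rank_expand_mat:
  assumes card: "CARD('K) = CARD('F) ^ m" and A: "A \<in> carrier_mat nr nc"
  shows "vec_space.rank (m * nr) (expand_mat A) = m * vec_space.rank nr A"
proof -
  have "CARD('F) ^ vec_space.rank (m * nr) (expand_mat A)
      = card ((*\<^sub>v) (expand_mat A) ` carrier_vec (m * nc))"
    using card_image_mult_mat_vec[OF expand_mat_carrier[OF A]] by simp
  also have "\<dots> = card ((*\<^sub>v) A ` carrier_vec nc)"
    unfolding range_expand_mat[OF A]
    by (rule card_image, rule inj_on_subset[OF bij_betw_imp_inj_on[OF bij_betw_flat_vec[of nr]]])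
      (use A in auto)
  also have "\<dots> = CARD('F) ^ (m * vec_space.rank nr A)"
    using card_image_mult_mat_vec[OF A] by (simp add: card power_mult)
  finally show ?thesis using card_field_gt_1[where 'a='F] by simp
qed

section \<open>Ferrers diagram codes\<close>

lemma length_blow_up: "length (blow_up m \<gamma>) = m * length \<gamma>"
  by (induction \<gamma>) (auto simp: blow_up_def)

text \<open>Removing the first column of the diagram removes \<open>m\<close> columns of the
  blow-up, and passing from \<open>J\<close> to \<open>J - m\<close> lowers \<open>J div m\<close>
  by one.\<close>

lemma nth_blow_up: "J < m * length \<gamma> \<Longrightarrow> blow_up m \<gamma> ! J = m * \<gamma> ! (J div m)"
proof (induction \<gamma> arbitrary: J)
  case (Cons g \<gamma>)
  have eq: "blow_up m (g # \<gamma>) = replicate m (m * g) @ blow_up m \<gamma>" by (simp add: blow_up_def)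
  show ?case
  proof (cases "J < m")
    case True
    then show ?thesis by (simp add: eq nth_append)
  next
    case False
    moreover have "m > 0" using Cons.prems by (cases m) auto
    ultimately have "J div m = Suc ((J - m) div m)" by (simp add: le_div_geq)
    moreover have "blow_up m \<gamma> ! (J - m) = m * \<gamma> ! ((J - m) div m)"
      using Cons.prems False by (intro Cons.IH) auto
    ultimately show ?thesis using False by (simp add: eq nth_append)
  qed
qed simp

lemma ferrers_diagram_blow_up:
  assumes "ferrers_diagram a n \<gamma>" and m: "m > 0"
  shows "ferrers_diagram (m * a) (m * n) (blow_up m \<gamma>)"
proof -
  have a: "a > 0" and n: "n > 0" and len: "length \<gamma> = n" and sorted: "sorted \<gamma>"
    and pos: "\<And>j. j < n \<Longrightarrow> 1 \<le> \<gamma> ! j" and last: "\<gamma> ! (n - 1) = a"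
    using assms(1) by (auto simp: ferrers_diagram_def)
  have div: "J div m < n" if "J < m * n" for J
    using that by (simp add: less_mult_imp_div_less mult.commute)
  have nth: "blow_up m \<gamma> ! J = m * \<gamma> ! (J div m)" if "J < m * n" for J
    using that nth_blow_up len by simp
  have "sorted (blow_up m \<gamma>)"
    unfolding sorted_iff_nth_mono length_blow_up len
    using nth div sorted len by (auto intro!: sorted_nth_mono div_le_mono)
  moreover have "1 \<le> blow_up m \<gamma> ! J" if "J < m * n" for J
    using nth[OF that] pos[OF div[OF that]] m by simp
  \<comment> \<open>The last new column belongs to the last block, so its height is
    \<open>m * a\<close>.\<close>
  moreover have "(m * n - 1) div m = n - 1"
  proof -
    have "m * (n - 1) \<le> m * n - 1" "m * n - 1 < m * Suc (n - 1)"
      using m n by (simp_all add: diff_mult_distrib2)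
    then show ?thesis by (intro div_nat_eqI)
  qed
  then have "blow_up m \<gamma> ! (m * n - 1) = m * a"
    using nth[of "m * n - 1"] m n last by simp
  ultimately show ?thesis
    using a n m by (auto simp: ferrers_diagram_def length_blow_up len)
qed

lemma (in field_coordinates) ferrers_code_expand_mat:
  assumes card: "CARD('K) = CARD('F) ^ m" and C: "ferrers_code a n \<gamma> k \<delta> C"
  shows "ferrers_code (m * a) (m * n) (blow_up m \<gamma>) (m * k) (m * \<delta>) (expand_mat ` C)"
proof -
  have diag: "ferrers_diagram a n \<gamma>"
    and sub: "VectorSpace.subspace class_ring C (module_mat TYPE('K) a n)"
    and dim: "vectorspace.dim class_ring ((module_mat TYPE('K) a n)\<lparr>carrier := C\<rparr>) = k"
    and dist: "min_rank_distance a n C \<delta>"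
    and zero: "\<And>M i j. M \<in> C \<Longrightarrow> i < a \<Longrightarrow> j < n \<Longrightarrow> (i, j) \<notin> dots \<gamma> \<Longrightarrow> M $$ (i, j) = 0"
    using C by (auto simp: ferrers_code_def)
  have len: "length \<gamma> = n" using diag by (simp add: ferrers_diagram_def)
  have submod: "submodule class_ring C (module_mat TYPE('K) a n)"
    using sub by (simp add: VectorSpace.subspace_def)
  have carr: "C \<subseteq> carrier_mat a n"
    using submodule.subset[OF submod] by (simp add: module_mat_simps)
  have inj: "inj_on expand_mat C"
    using inj_on_expand_mat carr by (rule inj_on_subset)
  have C0: "0\<^sub>m a n \<in> C"
    using submodule.zero_closed[OF submod] by (simp add: module_mat_simps)
  have Cadd: "A + B \<in> C" if "A \<in> C" "B \<in> C" for A B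
    using submodule.m_closed[OF submod] that by (simp add: module_mat_simps)
  have Csmult: "x \<cdot>\<^sub>m A \<in> C" if "A \<in> C" for x A
    using submodule.smult_closed[OF submod, of x A] that by (simp add: module_mat_simps)
  have sub': "VectorSpace.subspace class_ring (expand_mat ` C) (module_mat TYPE('F) (m * a) (m * n))"
  proof -
    have vs: "vectorspace (class_ring :: 'F ring) (module_mat TYPE('F) (m * a) (m * n))"
      by (rule matrix_vs)
    have "submodule class_ring (expand_mat ` C) (module_mat TYPE('F) (m * a) (m * n))"
    proof (intro submodule.intro)
      show "Module.module class_ring (module_mat TYPE('F) (m * a) (m * n))"
        using vs by (simp add: vectorspace_def)
      show "expand_mat ` C \<subseteq> carrier (module_mat TYPE('F) (m * a) (m * n))"
        using carr expand_mat_carrier by (auto simp: module_mat_simps)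
      show "\<zero>\<^bsub>module_mat TYPE('F) (m * a) (m * n)\<^esub> \<in> expand_mat ` C"
        using C0 by (auto simp: module_mat_simps expand_mat_zero intro!: image_eqI[where x = "0\<^sub>m a n"])
    next
      fix v w assume "v \<in> expand_mat ` C" "w \<in> expand_mat ` C"
      then obtain A B where AB: "A \<in> C" "B \<in> C" and vw: "v = expand_mat A" "w = expand_mat B" by blast
      have "v + w = expand_mat (A + B)" using vw expand_mat_add[OF subsetD[OF carr AB(1)] subsetD[OF carr AB(2)]] by simp
      then show "v \<oplus>\<^bsub>module_mat TYPE('F) (m * a) (m * n)\<^esub> w \<in> expand_mat ` C"
        using Cadd[OF AB] by (simp add: module_mat_simps)
    next
      fix x :: 'F and v assume "v \<in> expand_mat ` C"
      then obtain A where A: "A \<in> C" and v: "v = expand_mat A" by blast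
      \<comment> \<open>A scalar \<open>x\<close> of \<open>'F\<close> acts as
        \<open>\<phi> x\<close> on the original code, which is closed under all scalars of
        \<open>'K\<close>.\<close>
      then show "x \<odot>\<^bsub>module_mat TYPE('F) (m * a) (m * n)\<^esub> v \<in> expand_mat ` C"
        using imageI[OF Csmult[OF A, of "\<phi> x"], of expand_mat]
        by (simp add: module_mat_simps expand_mat_smult)
    qed
    with vs show ?thesis by (rule VectorSpace.subspace.intro)
  qed
  have dim': "vectorspace.dim class_ring ((module_mat TYPE('F) (m * a) (m * n))\<lparr>carrier := expand_mat ` C\<rparr>) = m * k"
  proof -
    have "CARD('F) ^ vectorspace.dim class_ring ((module_mat TYPE('F) (m * a) (m * n))\<lparr>carrier := expand_mat ` C\<rparr>)
        = card (expand_mat ` C)"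
      by (rule card_subspace_mat[OF sub', symmetric])
    also have "\<dots> = card C" by (rule card_image[OF inj])
    also have "\<dots> = CARD('F) ^ (m * k)"
      using card_subspace_mat[OF sub] by (simp add: dim card power_mult)
    finally show ?thesis using card_field_gt_1[where 'a='F] by simp
  qed
  \<comment> \<open>By injectivity nonzero codewords correspond to nonzero codewords, so attained
    and minimal ranks are both multiplied by \<open>m\<close>.\<close>
  have "expand_mat ` C - {0\<^sub>m (m * a) (m * n)} = expand_mat ` (C - {0\<^sub>m a n})"
    using inj C0 by (auto simp: inj_on_def simp flip: expand_mat_zero)
  moreover have "vec_space.rank (m * a) (expand_mat M) = m * vec_space.rank a M" if "M \<in> C" for M
    using rank_expand_mat[OF card, of M a n] carr that by auto
  ultimately have dist': "min_rank_distance (m * a) (m * n) (expand_mat ` C) (m * \<delta>)"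
    using dist by (auto simp: min_rank_distance_def)
  \<comment> \<open>A cell outside the blown-up diagram lies in the block of a cell outside the old
    one, where the entry is 0 and expands to a zero block.\<close>
  have "expand_mat M $$ (I, J) = 0"
    if M: "M \<in> C" and I: "I < m * a" and J: "J < m * n" and out: "(I, J) \<notin> dots (blow_up m \<gamma>)" for M I J
  proof -
    have "\<not> I < m * \<gamma> ! (J div m)"
      using out J len by (simp add: dots_def length_blow_up nth_blow_up)
    then have "(I div m, J div m) \<notin> dots \<gamma>"
      using m_pos by (auto simp: dots_def less_eq_div_iff_mult_less_eq mult.commute not_less)
    then have "M $$ (I div m, J div m) = 0"
      using zero[OF M] block_div_less[OF I] block_div_less[OF J] by simp
    then show ?thesis
      using M carr I J m_pos by (auto simp: expand_mat_def coords_0)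
  qed
  then show ?thesis
    using ferrers_diagram_blow_up[OF diag m_pos] sub' dim' dist' by (simp add: ferrers_code_def)
qed

theorem theorem3p3:
  fixes q m a n k \<delta> :: nat and \<gamma> :: "nat list"
  assumes "primepow q" and "m > 0"
    and "CARD('F::{field,finite}) = q"
    and "CARD('K::{field,finite}) = q ^ m"
    and "\<exists>C :: 'K mat set. ferrers_code a n \<gamma> k \<delta> C"
  shows "\<exists>C' :: 'F mat set. ferrers_code (m * a) (m * n) (blow_up m \<gamma>) (m * k) (m * \<delta>) C'"
proof -
  obtain p e where p: "prime p" and q: "q = p ^ e"
    using assms(1) by (auto simp: primepow_def)
  \<comment> \<open>Both cardinalities are powers of \<open>p\<close>, which gives the equal
    characteristics that the embedding requires.\<close>
  have "CHAR('F) = p" using p assms(3) q by (intro CHAR_eq_prime[of p e]) auto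
  moreover have "CHAR('K) = p"
    using p assms(4) q by (intro CHAR_eq_prime[of p "e * m"]) (auto simp: power_mult)
  ultimately have char: "CHAR('K) = CHAR('F)" by simp
  have card: "CARD('K) = CARD('F) ^ m" using assms by simp
  obtain \<phi> :: "'F \<Rightarrow> 'K" where "field_hom \<phi>"
    using finite_field_embedding[OF char card assms(2)] by blast
  then obtain b c where "field_coordinates \<phi> m b c"
    using field_coordinates_exist[OF _ card assms(2)] by blast
  then show ?thesis
    using field_coordinates.ferrers_code_expand_mat[OF _ card] assms(5) by blast
qed

end
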